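(* Let $n \geq k \geq t$ and $r$ be positive integers. Every minimum $(n,k,t,r)$-graph is a disjoint union of cliques.
   Context: A graph $G$ is an $(n,k,t)$-graph if $|V(G)| = n$ and every induced subgraph of $G$ on $k$ vertices contains a clique on $t$ vertices. A graph $G$ is an $(n,k,t,r)$-graph if it is an $(n,k,t)$-graph and its independence number satisfies $\alpha(G) = r$. A minimum $(n,k,t,r)$-graph is an $(n,k,t,r)$-graph with the minimum number of edges among all $(n,k,t,r)$-graphs. "Disjoint union" means vertex-disjoint union, and a disjoint union of cliques may include cliques on one vertex. *)

theory Defs
  imports "HOL-Library.Ramsey" "HOL-Library.Disjoint_Sets"
begin

text \<open>
  A graph is a pair of a vertex set and an edge set, edges being 2-element sets of vertices.
  The predicates \<^const>\<open>clique\<close> and \<^const>\<open>indep\<close> are those of the Ramsey theory in the library;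
  their first argument is a set of vertices, their second one the edge set.
\<close>

definition fin_sgraph :: "'a set \<Rightarrow> 'a set set \<Rightarrow> bool" where
  "fin_sgraph V E \<longleftrightarrow> finite V \<and> E \<subseteq> [V]\<^bsup>2\<^esup>"

definition induced_edges :: "'a set set \<Rightarrow> 'a set \<Rightarrow> 'a set set" where
  "induced_edges E S = {e \<in> E. e \<subseteq> S}"

definition independence_number :: "'a set \<Rightarrow> 'a set set \<Rightarrow> nat" where
  "independence_number V E = Max {card S |S. S \<subseteq> V \<and> indep S E}"

definition nkt_graph :: "nat \<Rightarrow> nat \<Rightarrow> nat \<Rightarrow> 'a set \<Rightarrow> 'a set set \<Rightarrow> bool" where
  "nkt_graph n k t V E \<longleftrightarrow>
     fin_sgraph V E \<and> card V = n \<and>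
     (\<forall>S. S \<subseteq> V \<and> card S = k \<longrightarrow>
        (\<exists>T. T \<subseteq> S \<and> card T = t \<and> clique T (induced_edges E S)))"

definition nktr_graph :: "nat \<Rightarrow> nat \<Rightarrow> nat \<Rightarrow> nat \<Rightarrow> 'a set \<Rightarrow> 'a set set \<Rightarrow> bool" where
  "nktr_graph n k t r V E \<longleftrightarrow> nkt_graph n k t V E \<and> independence_number V E = r"

text \<open>
  The competing graphs have vertices in the same type, but an arbitrary vertex set. Since that
  type contains a set of \<open>n\<close> vertices, every graph on \<open>n\<close> vertices is isomorphic to one of
  them; see \<open>min_nktr_graph_le\<close> below.
\<close>

definition min_nktr_graph :: "nat \<Rightarrow> nat \<Rightarrow> nat \<Rightarrow> nat \<Rightarrow> 'a set \<Rightarrow> 'a set set \<Rightarrow> bool" where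
  "min_nktr_graph n k t r V E \<longleftrightarrow>
     nktr_graph n k t r V E \<and>
     (\<forall>(V' :: 'a set) E'. nktr_graph n k t r V' E' \<longrightarrow> card E \<le> card E')"

definition disjoint_union_of_cliques :: "'a set \<Rightarrow> 'a set set \<Rightarrow> bool" where
  "disjoint_union_of_cliques V E \<longleftrightarrow>
     (\<exists>P. partition_on V P \<and> E = (\<Union>C\<in>P. [C]\<^bsup>2\<^esup>))"

lemma inj_on_image_edge_mem_iff:
  assumes f: "inj_on f V" and E: "E \<subseteq> [V]\<^bsup>2\<^esup>" and e: "e \<subseteq> V"
  shows "f ` e \<in> (`) f ` E \<longleftrightarrow> e \<in> E"
proof
  assume "f ` e \<in> (`) f ` E"
  then obtain e' where e': "e' \<in> E" "f ` e = f ` e'" by auto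
  moreover from e' E have "e' \<subseteq> V" by (auto simp: nsets_def)
  ultimately show "e \<in> E" using inj_on_image_eq_iff[OF f e] by auto
qed auto

lemma nktr_graph_image:
  assumes f: "inj_on f V" and G: "nktr_graph n k t r V E"
  shows "nktr_graph n k t r (f ` V) ((`) f ` E)" and "card ((`) f ` E) = card E"
proof -
  let ?E = "(`) f ` E"
  have fin: "finite V" and EV: "E \<subseteq> [V]\<^bsup>2\<^esup>" and n: "card V = n"
    and cl: "\<And>S. S \<subseteq> V \<Longrightarrow> card S = k \<Longrightarrow>
               \<exists>T. T \<subseteq> S \<and> card T = t \<and> clique T (induced_edges E S)"
    and r: "independence_number V E = r"
    using G by (auto simp: nktr_graph_def nkt_graph_def fin_sgraph_def)
  have edge: "{f v, f w} \<in> ?E \<longleftrightarrow> {v, w} \<in> E" if "v \<in> V" "w \<in> V" for v w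
    using inj_on_image_edge_mem_iff[OF f EV, of "{v, w}"] that by simp
  have card_f: "card (f ` S) = card S" if "S \<subseteq> V" for S
    using card_image inj_on_subset[OF f that] by blast
  have EV': "?E \<subseteq> [f ` V]\<^bsup>2\<^esup>"
  proof
    fix e' assume "e' \<in> ?E"
    then obtain e where "e \<in> E" and e': "e' = f ` e" by auto
    then have "e \<subseteq> V" "finite e" "card e = 2" using EV by (auto simp: nsets_def)
    then show "e' \<in> [f ` V]\<^bsup>2\<^esup>" using card_f[of e] e' by (auto simp: nsets_def)
  qed
  have indep_f: "indep (f ` S) ?E \<longleftrightarrow> indep S E" if "S \<subseteq> V" for S
  proof -
    have "f v = f w \<longleftrightarrow> v = w" and "{f v, f w} \<in> ?E \<longleftrightarrow> {v, w} \<in> E"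
      if "v \<in> S" "w \<in> S" for v w
      using that \<open>S \<subseteq> V\<close> edge f by (auto simp: inj_on_eq_iff subset_iff)
    then show ?thesis unfolding indep_def by (simp add: ball_simps)
  qed
  have "{card S |S. S \<subseteq> f ` V \<and> indep S ?E} = {card S |S. S \<subseteq> V \<and> indep S E}"
  proof safe
    fix S assume S: "S \<subseteq> f ` V" "indep S ?E"
    then obtain S0 where "S0 \<subseteq> V" "S = f ` S0" by (auto simp: subset_image_iff)
    with S show "\<exists>S0. card S = card S0 \<and> S0 \<subseteq> V \<and> indep S0 E"
      using card_f indep_f by blast
  next
    fix S assume "S \<subseteq> V" "indep S E"
    then show "\<exists>S0. card S = card S0 \<and> S0 \<subseteq> f ` V \<and> indep S0 ?E"
      using card_f indep_f by (intro exI[of _ "f ` S"]) auto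
  qed
  then have r': "independence_number (f ` V) ?E = r"
    using r by (simp add: independence_number_def)
  have "\<exists>T. T \<subseteq> S \<and> card T = t \<and> clique T (induced_edges ?E S)"
    if S: "S \<subseteq> f ` V" "card S = k" for S
  proof -
    obtain S0 where S0: "S0 \<subseteq> V" "S = f ` S0" using S by (auto simp: subset_image_iff)
    then obtain T where T: "T \<subseteq> S0" "card T = t" "clique T (induced_edges E S0)"
      using cl[of S0] S card_f by auto
    have "T \<subseteq> V" using T S0 by blast
    moreover have "clique (f ` T) (induced_edges ?E S)"
      unfolding clique_def
    proof (intro ballI impI)
      fix a b assume "a \<in> f ` T" "b \<in> f ` T" "a \<noteq> b"
      then obtain v w where vw: "v \<in> T" "w \<in> T" "v \<noteq> w" "a = f v" "b = f w" by auto
      then have "{v, w} \<in> E" using T(3) by (auto simp: clique_def induced_edges_def)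
      then show "{a, b} \<in> induced_edges ?E S"
        using vw edge[of v w] T(1) S0 \<open>T \<subseteq> V\<close> by (auto simp: induced_edges_def)
    qed
    ultimately show ?thesis
      using T S0 card_f[of T] by (intro exI[of _ "f ` T"]) auto
  qed
  then show "nktr_graph n k t r (f ` V) ?E"
    using r' EV' fin n card_f[of V] by (auto simp: nktr_graph_def nkt_graph_def fin_sgraph_def)
  have "inj_on ((`) f) E"
    using EV by (intro inj_on_subset[OF inj_on_image_Pow[OF f]]) (auto simp: nsets_def)
  then show "card ?E = card E" by (rule card_image)
qed

lemma min_nktr_graph_le:
  fixes V :: "'a set" and V' :: "'b set"
  assumes "min_nktr_graph n k t r V E" and "nktr_graph n k t r V' E'"
  shows "card E \<le> card E'"
proof -
  have "finite V" "card V = n" "finite V'" "card V' = n"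
    using assms by (auto simp: min_nktr_graph_def nktr_graph_def nkt_graph_def fin_sgraph_def)
  then obtain f where "bij_betw f V' V" using finite_same_card_bij by metis
  then show ?thesis
    using nktr_graph_image[of f V' n k t r E'] assms
    unfolding min_nktr_graph_def bij_betw_def by metis
qed

end

theory Submission
  imports Defs
begin

text \<open>
  Peel maximum independent sets \<open>I\<^sub>1, I\<^sub>2, \<dots>\<close> off the graph one after the other. By maximality
  every vertex of \<open>I\<^sub>j\<close> has a neighbour in each of \<open>I\<^sub>1, \<dots>, I\<^bsub>j-1\<^esub>\<close>, so there are at least
  \<open>\<Sum>j. (j - 1) * card I\<^sub>j\<close> edges. This is the number of edges of the disjoint union of cliques
  whose clique sizes form the partition conjugate to \<open>card I\<^sub>1, card I\<^sub>2, \<dots>\<close>. That union has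
  \<open>card I\<^sub>1 = r\<close> cliques, and its largest set without a \<open>t\<close>-clique has the same size as
  \<open>I\<^sub>1 \<union> \<dots> \<union> I\<^bsub>t-1\<^esub>\<close>, which contains no \<open>t\<close>-clique of the given graph; so it is again an
  \<open>(n,k,t,r)\<close>-graph. If the given graph is not a disjoint union of cliques, then the sets \<open>I\<^sub>j\<close>
  can be chosen so that some vertex has two neighbours in an earlier set, which makes the
  comparison strict.
\<close>

section \<open>Independent sets of maximum size\<close>

lemma independence_number_ge:
  assumes "finite V" "S \<subseteq> V" "indep S E"
  shows "card S \<le> independence_number V E"
proof -
  have "finite {card S |S. S \<subseteq> V \<and> indep S E}" using assms(1) by simp
  then show ?thesis unfolding independence_number_def using assms by (intro Max_ge) auto
qed

lemma independence_number_attained: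
  assumes "finite V"
  obtains I where "I \<subseteq> V" "indep I E" "card I = independence_number V E"
proof -
  have "finite {card S |S. S \<subseteq> V \<and> indep S E}" using assms by simp
  moreover have "card {} \<in> {card S |S. S \<subseteq> V \<and> indep S E}"
    by (rule CollectI, rule exI[of _ "{}"]) (simp add: indep_def)
  ultimately have "independence_number V E \<in> {card S |S. S \<subseteq> V \<and> indep S E}"
    unfolding independence_number_def by (intro Max_in) auto
  then show ?thesis using that by auto
qed

lemma independence_number_mono:
  assumes "finite V" "W \<subseteq> V"
  shows "independence_number W E \<le> independence_number V E"
proof -
  obtain I where "I \<subseteq> W" "indep I E" "card I = independence_number W E"
    using independence_number_attained finite_subset assms by metis
  then show ?thesis using independence_number_ge[of V I E] assms by auto
qed

section \<open>Disjoint unions of cliques as graphs without induced paths on three vertices\<close>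

definition cluster_on :: "'a set \<Rightarrow> 'a set set \<Rightarrow> bool" where
  "cluster_on V E \<longleftrightarrow>
     (\<forall>a\<in>V. \<forall>b\<in>V. \<forall>c\<in>V. a \<noteq> c \<longrightarrow> {a, b} \<in> E \<longrightarrow> {b, c} \<in> E \<longrightarrow> {a, c} \<in> E)"

text \<open>The cliques are the classes of the relation "equal or adjacent". Equality has to be
  added because \<open>E\<close> has no loops; transitivity is what \<open>cluster_on\<close>
  provides.\<close>

lemma disjoint_union_of_cliques_if_cluster_on:
  assumes E: "E \<subseteq> [V]\<^bsup>2\<^esup>" and cl: "cluster_on V E"
  shows "disjoint_union_of_cliques V E"
proof -
  define R where "R = {(x, y). x \<in> V \<and> y \<in> V \<and> (x = y \<or> {x, y} \<in> E)}"
  have "equiv V R"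
  proof (rule equivI)
    show "R \<subseteq> V \<times> V" by (auto simp: R_def)
    show "refl_on V R" by (auto simp: R_def refl_on_def)
    show "sym R" by (auto simp: R_def sym_def insert_commute)
    show "trans R"
    proof (rule transI)
      fix x y z assume "(x, y) \<in> R" "(y, z) \<in> R"
      then show "(x, z) \<in> R"
        using cl unfolding R_def cluster_on_def by blast
    qed
  qed
  then have P: "partition_on V (V // R)" by (rule partition_on_quotient)
  have "E = (\<Union>C\<in>V // R. [C]\<^bsup>2\<^esup>)"
  proof (intro subset_antisym subsetI)
    fix e assume e: "e \<in> E"
    then obtain x y where xy: "e = {x, y}" "x \<noteq> y" "x \<in> V" "y \<in> V"
      using E by (auto simp: nsets_def card_2_iff)
    then have "e \<in> [R `` {x}]\<^bsup>2\<^esup>" using e by (auto simp: nsets_def R_def)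
    moreover have "R `` {x} \<in> V // R" using xy by (auto intro: quotientI)
    ultimately show "e \<in> (\<Union>C\<in>V // R. [C]\<^bsup>2\<^esup>)" by blast
  next
    fix e assume "e \<in> (\<Union>C\<in>V // R. [C]\<^bsup>2\<^esup>)"
    then obtain C where C: "C \<in> V // R" "e \<in> [C]\<^bsup>2\<^esup>" by blast
    then obtain x y where xy: "e = {x, y}" "x \<noteq> y" "x \<in> C" "y \<in> C"
      by (auto simp: nsets_def card_2_iff)
    then have "(x, y) \<in> R" using quotient_eq_iff[OF \<open>equiv V R\<close> C(1) C(1)] by auto
    then show "e \<in> E" using xy by (auto simp: R_def)
  qed
  with P show ?thesis unfolding disjoint_union_of_cliques_def by blast
qed

section \<open>Neighbours in a maximum independent set\<close>

lemma max_indep_neighbour: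
  assumes V: "finite V" and I: "I \<subseteq> V" "indep I E" "card I = independence_number V E"
    and v: "v \<in> V - I"
  shows "\<exists>x\<in>I. {v, x} \<in> E"
proof (rule ccontr)
  assume "\<not> ?thesis"
  then have "indep (insert v I) E" using I(2) by (auto simp: indep_def insert_commute)
  then have "card (insert v I) \<le> card I"
    using independence_number_ge[OF V, of "insert v I" E] I v by auto
  then show False using v I(1) V finite_subset[OF I(1)] by simp
qed

text \<open>The exchange argument behind the strict comparison.\<close>

lemma cluster_on_if_unique_neighbours:
  assumes V: "finite V"
    and cl: "\<And>I. I \<subseteq> V \<Longrightarrow> indep I E \<Longrightarrow> card I = independence_number V E \<Longrightarrow>
               cluster_on (V - I) E"
    and uniq: "\<And>I v x y. I \<subseteq> V \<Longrightarrow> indep I E \<Longrightarrow> card I = independence_number V E \<Longrightarrow>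
               v \<in> V - I \<Longrightarrow> x \<in> I \<Longrightarrow> y \<in> I \<Longrightarrow> {v, x} \<in> E \<Longrightarrow> {v, y} \<in> E \<Longrightarrow> x = y"
  shows "cluster_on V E"
proof -
  obtain I where I: "I \<subseteq> V" "indep I E" "card I = independence_number V E"
    using independence_number_attained V by metis
  have finI: "finite I" using I V finite_subset by blast
  have no: "x \<notin> I \<or> y \<notin> I" if "{x, y} \<in> E" "x \<noteq> y" for x y
    using I(2) that by (auto simp: indep_def)
  have end_in_I: False
    if "a \<in> I" "b \<in> V - I" "c \<in> V - I" "b \<noteq> c" "{a, b} \<in> E" "{b, c} \<in> E" "{a, c} \<notin> E"
    for a b c
  proof -
    obtain y where y: "y \<in> I" "{c, y} \<in> E"
      using max_indep_neighbour[OF V I] \<open>c \<in> V - I\<close> by blast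
    have "y \<noteq> a" using y that by (auto simp: insert_commute)
    \<comment> \<open>Trade \<open>a\<close> for \<open>b\<close>. Since \<open>a\<close> is the
      only neighbour of \<open>b\<close> in \<open>I\<close>, the result is again a maximum
      independent set. It keeps \<open>y\<close>, so \<open>c\<close> now has the two neighbours
      \<open>b\<close> and \<open>y\<close> in it, against \<open>uniq\<close>.\<close>
    define J where "J = insert b (I - {a})"
    have "{b, x} \<notin> E" if "x \<in> I - {a}" for x
      using uniq[OF I \<open>b \<in> V - I\<close> \<open>a \<in> I\<close>, of x] that \<open>{a, b} \<in> E\<close>
      by (auto simp: insert_commute)
    then have "indep J E" using I(2) by (auto simp: indep_def J_def insert_commute)
    moreover have "J \<subseteq> V" using I(1) that by (auto simp: J_def)
    moreover have "card J = card I"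
      using that(1,2) finI card.remove[of I a] unfolding J_def
      by (subst card_insert_disjoint) auto
    moreover have "c \<in> V - J" "b \<in> J" "y \<in> J" using that y \<open>y \<noteq> a\<close> by (auto simp: J_def)
    moreover have "{c, b} \<in> E" using that by (simp add: insert_commute)
    ultimately have "b = y" using uniq[of J c b y] I(3) y(2) by simp
    then show False using y that by auto
  qed
  show ?thesis unfolding cluster_on_def
  proof (intro ballI impI, rule ccontr)
    fix a b c
    assume abc: "a \<in> V" "b \<in> V" "c \<in> V" "a \<noteq> c" "{a, b} \<in> E" "{b, c} \<in> E" "{a, c} \<notin> E"
    then have ne: "a \<noteq> b" "b \<noteq> c" by auto
    consider "b \<in> I" | "b \<notin> I" "a \<in> I" "c \<in> I" | "b \<notin> I" "a \<in> I" "c \<notin> I"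
      | "b \<notin> I" "a \<notin> I" "c \<in> I" | "b \<notin> I" "a \<notin> I" "c \<notin> I" by blast
    then show False
    proof cases
      case 1
      then have out: "a \<in> V - I" "c \<in> V - I" using no[of a b] no[of b c] ne abc by auto
      \<comment> \<open>Neither \<open>a\<close> nor \<open>c\<close> has a neighbour in
        \<open>I\<close> other than \<open>b\<close>, so replacing \<open>b\<close> by both of them
        gives an independent set that is too large.\<close>
      have "{a, x} \<notin> E" "{c, x} \<notin> E" if "x \<in> I - {b}" for x
        using uniq[OF I out(1) 1, of x] uniq[OF I out(2) 1, of x] that abc
        by (auto simp: insert_commute)
      then have "indep (insert a (insert c (I - {b}))) E"
        using I(2) abc by (auto simp: indep_def insert_commute)
      then have "card (insert a (insert c (I - {b}))) \<le> card I"
        using independence_number_ge[OF V, of "insert a (insert c (I - {b}))" E] I abc by auto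
      moreover have "card (insert a (insert c (I - {b}))) = Suc (card I)"
        using out abc(4) finI card.remove[OF finI 1] by simp
      ultimately show False by simp
    next
      case 2
      then show False using uniq[OF I, of b a c] abc by (auto simp: insert_commute)
    next
      case 3
      then show False using end_in_I[of a b c] abc ne by auto
    next
      case 4
      then show False using end_in_I[of c b a] abc ne by (auto simp: insert_commute)
    next
      case 5
      then show False using cl[OF I] abc unfolding cluster_on_def by blast
    qed
  qed
qed

section \<open>Counting edges while peeling off independent sets\<close>

lemma card_edges_ge_split:
  assumes V: "finite V" and I: "I \<subseteq> V"
  shows "card (E \<inter> [V - I]\<^bsup>2\<^esup>) + (\<Sum>v\<in>V - I. card {x \<in> I. {v, x} \<in> E}) \<le> card (E \<inter> [V]\<^bsup>2\<^esup>)"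
proof -
  \<comment> \<open>\<open>B\<close> consists of the edges between \<open>V - I\<close> and
    \<open>I\<close>. Listing the outer endpoint first makes the pair in \<open>X\<close>
    recoverable from its edge. Edges inside \<open>I\<close> are not counted, hence only an
    inequality.\<close>
  define X where "X = (SIGMA v:V - I. {x \<in> I. {v, x} \<in> E})"
  define B where "B = (\<lambda>(v, x). {v, x}) ` X"
  have finX: "finite X" unfolding X_def using V finite_subset[OF I V] by (intro finite_SigmaI) auto
  have "inj_on (\<lambda>(v, x). {v, x}) X"
    by (rule inj_onI) (auto simp: X_def doubleton_eq_iff)
  then have "card B = card X" unfolding B_def by (rule card_image)
  also have "\<dots> = (\<Sum>v\<in>V - I. card {x \<in> I. {v, x} \<in> E})"
    unfolding X_def using V finite_subset[OF I V] by (subst card_SigmaI) auto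
  finally have B: "card B = (\<Sum>v\<in>V - I. card {x \<in> I. {v, x} \<in> E})" .
  have "E \<inter> [V - I]\<^bsup>2\<^esup> \<inter> B = {}" by (auto simp: B_def X_def nsets_def)
  moreover have fin: "finite (E \<inter> [V]\<^bsup>2\<^esup>)" using V by (simp add: finite_imp_finite_nsets)
  moreover have sub: "E \<inter> [V - I]\<^bsup>2\<^esup> \<union> B \<subseteq> E \<inter> [V]\<^bsup>2\<^esup>"
  proof -
    have "B \<subseteq> E \<inter> [V]\<^bsup>2\<^esup>"
    proof
      fix e assume "e \<in> B"
      then obtain v x where "e = {v, x}" "v \<in> V - I" "x \<in> I" "{v, x} \<in> E"
        by (auto simp: B_def X_def)
      moreover from this have "v \<noteq> x" by auto
      ultimately show "e \<in> E \<inter> [V]\<^bsup>2\<^esup>" using I by (auto simp: nsets_def)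
    qed
    then show ?thesis by (auto simp: nsets_def)
  qed
  moreover have "finite (E \<inter> [V - I]\<^bsup>2\<^esup>)" "finite B"
    using finite_subset[OF sub fin] by auto
  ultimately show ?thesis using B card_Un_disjoint[of "E \<inter> [V - I]\<^bsup>2\<^esup>" B] card_mono[OF fin sub]
    by simp
qed

text \<open>The numbers \<open>c i\<close> are the sizes of the cliques in the competing disjoint union.\<close>

lemma clique_sizes_exist:
  assumes "finite V"
  shows "\<exists>c :: nat \<Rightarrow> nat.
    (\<forall>i. 0 < c i \<longleftrightarrow> i < independence_number V E) \<and>
    (\<Sum>i<independence_number V E. c i) = card V \<and>
    (\<Sum>i<independence_number V E. c i choose 2) \<le> card (E \<inter> [V]\<^bsup>2\<^esup>) \<and>
    (\<not> cluster_on V E \<longrightarrow> (\<Sum>i<independence_number V E. c i choose 2) < card (E \<inter> [V]\<^bsup>2\<^esup>)) \<and>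
    (\<forall>s. \<exists>T\<subseteq>V. card T = (\<Sum>i<independence_number V E. min (c i) s) \<and>
           (\<forall>X\<subseteq>T. clique X E \<longrightarrow> card X \<le> s))"
  using assms
proof (induction "card V" arbitrary: V rule: less_induct)
  case less
  note V = \<open>finite V\<close>
  define r where "r = independence_number V E"
  show ?case
  proof (cases "V = {}")
    case True
    then have "r = 0" unfolding r_def by (metis independence_number_attained V card.empty subset_empty)
    moreover have "cluster_on V E" using True by (simp add: cluster_on_def)
    ultimately show ?thesis using True unfolding r_def[symmetric]
      by (intro exI[of _ "\<lambda>_. 0"]) auto
  next
    case False
    let ?N = "\<lambda>I v. {x \<in> I. {v, x} \<in> E}"
    \<comment> \<open>Contraposition of \<open>cluster_on_if_unique_neighbours\<close>: if
      \<open>cluster_on V E\<close> fails, some choice of \<open>I\<close> either leaves the failure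
      in the remainder, where induction gives strictness, or yields a surplus edge at a vertex
      outside \<open>I\<close>.\<close>
    obtain I where I: "I \<subseteq> V" "indep I E" "card I = r"
      and strict: "\<not> cluster_on V E \<Longrightarrow> \<not> cluster_on (V - I) E \<or>
        (\<exists>v\<in>V - I. \<exists>x\<in>I. \<exists>y\<in>I. x \<noteq> y \<and> {v, x} \<in> E \<and> {v, y} \<in> E)"
    proof (cases "cluster_on V E")
      case True
      then show thesis using that independence_number_attained[OF V] r_def by metis
    next
      case False
      then show thesis using that cluster_on_if_unique_neighbours[OF V, of E] r_def by metis
    qed
    have finI: "finite I" using I V finite_subset by blast
    \<comment> \<open>The induced subgraph on the remainder is represented by \<open>W\<close> with
      the same \<open>E\<close>; all the notions involved look only at edges within the vertex
      set.\<close>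
    define W where "W = V - I"
    have W: "finite W" "W \<subseteq> V" using V by (auto simp: W_def)
    have Ipos: "I \<noteq> {}"
    proof
      assume "I = {}"
      obtain v where "v \<in> V" using False by blast
      then have "card {v} \<le> r"
        unfolding r_def using V by (intro independence_number_ge) (auto simp: indep_def)
      then show False using I \<open>I = {}\<close> by simp
    qed
    have "card W < card V"
      using Ipos I V by (intro psubset_card_mono) (auto simp: W_def)
    define m where "m = independence_number W E"
    have "m \<le> r" unfolding m_def r_def using V W by (intro independence_number_mono)
    obtain c where c: "\<And>i. 0 < c i \<longleftrightarrow> i < m"
      and csum: "(\<Sum>i<m. c i) = card W"
      and cle: "(\<Sum>i<m. c i choose 2) \<le> card (E \<inter> [W]\<^bsup>2\<^esup>)"
      and clt: "\<not> cluster_on W E \<Longrightarrow> (\<Sum>i<m. c i choose 2) < card (E \<inter> [W]\<^bsup>2\<^esup>)"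
      and cT: "\<And>s. \<exists>T\<subseteq>W. card T = (\<Sum>i<m. min (c i) s) \<and>
           (\<forall>X\<subseteq>T. clique X E \<longrightarrow> card X \<le> s)"
      using less.hyps[OF \<open>card W < card V\<close> W(1)] unfolding m_def[symmetric] by metis
    have c0: "c i = 0" if "\<not> i < m" for i using c[of i] that by simp
    \<comment> \<open>Empty cliques may be added at the indices from \<open>m\<close> to
      \<open>r - 1\<close> without changing the sums.\<close>
    have ext: "(\<Sum>i<r. g (c i)) = (\<Sum>i<m. g (c i))" if "g 0 = 0" for g :: "nat \<Rightarrow> nat"
      using \<open>m \<le> r\<close> c0 that by (intro sum.mono_neutral_right) auto
    \<comment> \<open>Distribute the \<open>r\<close> vertices of \<open>I\<close>, one to each
      clique: the \<open>m\<close> old cliques grow by one vertex, and \<open>r - m\<close> new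
      singletons arise.\<close>
    define d where "d = (\<lambda>i. if i < r then Suc (c i) else 0)"
    have dsum: "(\<Sum>i<r. g (d i)) = (\<Sum>i<r. g (Suc (c i)))" for g :: "nat \<Rightarrow> nat"
      by (intro sum.cong) (auto simp: d_def)
    have cardV: "card V = card W + r"
      using I V finI card_Diff_subset[OF finI I(1)] card_mono[OF V I(1)] by (simp add: W_def)
    have d1: "(\<Sum>i<r. d i) = card V"
      using dsum[of "\<lambda>x. x"] ext[of "\<lambda>x. x"] csum cardV by (simp add: sum_Suc)
    \<comment> \<open>A new vertex in a clique of size \<open>c i\<close> costs \<open>c i\<close>
      edges, in total \<open>card W\<close>. The graph itself pays for this with at least one edge
      into \<open>I\<close> from each vertex of \<open>W\<close>.\<close>
    have d2: "(\<Sum>i<r. d i choose 2) = (\<Sum>i<m. c i choose 2) + card W"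
    proof -
      have "(\<Sum>i<r. d i choose 2) = (\<Sum>i<r. c i + (c i choose 2))"
        using dsum[of "\<lambda>x. x choose 2"] by (simp add: numeral_2_eq_2)
      also have "\<dots> = (\<Sum>i<m. c i) + (\<Sum>i<m. c i choose 2)"
        using ext[of "\<lambda>x. x"] ext[of "\<lambda>x. x choose 2"] by (simp add: sum.distrib)
      finally show ?thesis using csum by simp
    qed
    have N1: "1 \<le> card (?N I v)" if "v \<in> W" for v
    proof -
      have "?N I v \<noteq> {}"
        using max_indep_neighbour[OF V I(1,2), of v] I(3) that by (auto simp: W_def r_def)
      then show ?thesis using finI by (simp add: Suc_le_eq card_gt_0_iff)
    qed
    have Nle: "card W \<le> (\<Sum>v\<in>W. card (?N I v))"
      using sum_mono[of W "\<lambda>_. 1" "\<lambda>v. card (?N I v)"] N1 by simp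
    have split: "card (E \<inter> [W]\<^bsup>2\<^esup>) + (\<Sum>v\<in>W. card (?N I v)) \<le> card (E \<inter> [V]\<^bsup>2\<^esup>)"
      using card_edges_ge_split[OF V I(1), of E] by (simp add: W_def)
    have d3: "(\<Sum>i<r. d i choose 2) \<le> card (E \<inter> [V]\<^bsup>2\<^esup>)"
      using d2 cle Nle split by linarith
    \<comment> \<open>Strictness comes from the induction hypothesis on \<open>W\<close>, or else
      from a vertex of \<open>W\<close> that sends two edges into \<open>I\<close>.\<close>
    have d4: "(\<Sum>i<r. d i choose 2) < card (E \<inter> [V]\<^bsup>2\<^esup>)" if not_cl: "\<not> cluster_on V E"
    proof (cases "cluster_on W E")
      case False
      then show ?thesis using d2 clt Nle split by linarith
    next
      case True
      then obtain v x y where v: "v \<in> W" "x \<in> I" "y \<in> I" "x \<noteq> y" "{v, x} \<in> E" "{v, y} \<in> E"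
        using strict[OF not_cl] unfolding W_def by blast
      then have "card {x, y} \<le> card (?N I v)" using finI by (intro card_mono) auto
      then have "1 < card (?N I v)" using v by simp
      then have "(\<Sum>v\<in>W. 1) < (\<Sum>v\<in>W. card (?N I v))"
        using W N1 v by (intro sum_strict_mono_ex1) auto
      then show ?thesis using d2 cle split by simp
    qed
    have d5: "\<exists>T\<subseteq>V. card T = (\<Sum>i<r. min (d i) s) \<and> (\<forall>X\<subseteq>T. clique X E \<longrightarrow> card X \<le> s)" for s
    proof (cases s)
      case 0
      then show ?thesis by (intro exI[of _ "{}"]) auto
    next
      \<comment> \<open>Add \<open>I\<close> to the set obtained for \<open>s'\<close>: a clique has
        at most one vertex in \<open>I\<close>, and each of the \<open>r\<close> summands grows by
        exactly one, including those with \<open>c i = 0\<close>. This is why the claim is carried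
        through the induction for all \<open>s\<close>.\<close>
      case (Suc s')
      obtain T where T: "T \<subseteq> W" "card T = (\<Sum>i<m. min (c i) s')"
        "\<And>X. X \<subseteq> T \<Longrightarrow> clique X E \<Longrightarrow> card X \<le> s'"
        using cT[of s'] by blast
      have finT: "finite T" using T W finite_subset by blast
      have "card (T \<union> I) = card T + r"
        using T finT finI I by (subst card_Un_disjoint) (auto simp: W_def)
      also have "\<dots> = (\<Sum>i<r. Suc (min (c i) s'))"
        using T(2) ext[of "\<lambda>x. min x s'"] by (simp add: sum_Suc)
      also have "\<dots> = (\<Sum>i<r. min (d i) s)"
        using dsum[of "\<lambda>x. min x s"] Suc by simp
      finally have "card (T \<union> I) = (\<Sum>i<r. min (d i) s)" .
      moreover have "card X \<le> s" if X: "X \<subseteq> T \<union> I" "clique X E" for X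
      proof -
        have "card (X \<inter> T) \<le> s'" using X T(3)[of "X \<inter> T"] by (auto simp: clique_def)
        moreover have "card (X \<inter> I) \<le> Suc 0"
          using X(2) I(2) finI unfolding clique_def indep_def
          by (subst card_le_Suc0_iff_eq) blast+
        moreover have "card X \<le> card (X \<inter> T) + card (X \<inter> I)"
          using card_Un_le[of "X \<inter> T" "X \<inter> I"] X(1) by (simp add: Int_Un_distrib[symmetric] Int_absorb2)
        ultimately show ?thesis using Suc by linarith
      qed
      ultimately show ?thesis using T I W by (intro exI[of _ "T \<union> I"]) auto
    qed
    have d0: "0 < d i \<longleftrightarrow> i < r" for i by (simp add: d_def)
    show ?thesis unfolding r_def[symmetric] using d0 d1 d3 d4 d5
      by (intro exI[of _ d] conjI allI impI)
  qed
qed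

section \<open>The competing disjoint union of cliques\<close>

definition cluster_verts :: "nat \<Rightarrow> (nat \<Rightarrow> nat) \<Rightarrow> (nat \<times> nat) set" where
  "cluster_verts r c = (SIGMA i:{..<r}. {..<c i})"

definition cluster_edges :: "nat \<Rightarrow> (nat \<Rightarrow> nat) \<Rightarrow> (nat \<times> nat) set set" where
  "cluster_edges r c = (\<Union>i<r. [{i} \<times> {..<c i}]\<^bsup>2\<^esup>)"

lemma cluster_edge_iff:
  assumes "p \<in> cluster_verts r c" "q \<in> cluster_verts r c" "p \<noteq> q"
  shows "{p, q} \<in> cluster_edges r c \<longleftrightarrow> fst p = fst q"
  using assms by (auto simp: cluster_edges_def cluster_verts_def nsets_def)

lemma card_cluster_edges: "card (cluster_edges r c) = (\<Sum>i<r. c i choose 2)"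
proof -
  have "[{i} \<times> {..<c i}]\<^bsup>2\<^esup> \<inter> [{j} \<times> {..<c j}]\<^bsup>2\<^esup> = {}" if "i \<noteq> j" for i j
  proof -
    have False if "e \<in> [{i} \<times> {..<c i}]\<^bsup>2\<^esup>" "e \<in> [{j} \<times> {..<c j}]\<^bsup>2\<^esup>" for e
    proof -
      have "e \<subseteq> {}" "card e = 2" using that \<open>i \<noteq> j\<close> by (auto simp: nsets_def)
      then show False by simp
    qed
    then show ?thesis by blast
  qed
  then have "card (cluster_edges r c) = (\<Sum>i<r. card ([{i} \<times> {..<c i}]\<^bsup>2\<^esup>))"
    unfolding cluster_edges_def by (intro card_UN_disjoint) (auto intro: finite_imp_finite_nsets)
  then show ?thesis by (simp add: card_nsets card_cartesian_product)
qed

text \<open>An independent set has at most one vertex in each clique, so \<open>fst\<close> is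
  injective on it. Conversely the vertices \<open>(i, 0)\<close>, which exist because no clique is
  empty, form an independent set of size \<open>r\<close>.\<close>

lemma independence_number_cluster:
  assumes c: "\<And>i. i < r \<Longrightarrow> 0 < c i"
  shows "independence_number (cluster_verts r c) (cluster_edges r c) = r"
proof (rule antisym)
  have fin: "finite (cluster_verts r c)" by (auto simp: cluster_verts_def)
  obtain S where S: "S \<subseteq> cluster_verts r c" "indep S (cluster_edges r c)"
    "card S = independence_number (cluster_verts r c) (cluster_edges r c)"
    using independence_number_attained[OF fin] by metis
  have "inj_on fst S"
  proof (rule inj_onI, rule ccontr)
    fix p q assume pq: "p \<in> S" "q \<in> S" "fst p = fst q" "p \<noteq> q"
    then have "{p, q} \<in> cluster_edges r c" using S cluster_edge_iff[of p r c q] by auto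
    then show False using S(2) pq by (auto simp: indep_def)
  qed
  moreover have "fst ` S \<subseteq> {..<r}" using S(1) by (auto simp: cluster_verts_def)
  ultimately have "card S \<le> card {..<r}" by (intro card_inj_on_le) auto
  then show "independence_number (cluster_verts r c) (cluster_edges r c) \<le> r" using S by simp
  let ?J = "(\<lambda>i. (i, 0::nat)) ` {..<r}"
  have J: "?J \<subseteq> cluster_verts r c" using c by (auto simp: cluster_verts_def)
  moreover have "indep ?J (cluster_edges r c)"
    unfolding indep_def
  proof (intro ballI impI)
    fix p q assume pq: "p \<in> ?J" "q \<in> ?J" "p \<noteq> q"
    then have "fst p \<noteq> fst q" by auto
    then show "{p, q} \<notin> cluster_edges r c" using pq J cluster_edge_iff[of p r c q] by blast
  qed
  ultimately have "card ?J \<le> independence_number (cluster_verts r c) (cluster_edges r c)"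
    by (rule independence_number_ge[OF fin])
  then show "r \<le> independence_number (cluster_verts r c) (cluster_edges r c)"
    by (simp add: card_image inj_on_def)
qed

text \<open>Pigeonhole: a vertex set with at most \<open>t - 1\<close> vertices in each clique has
  at most \<open>(\<Sum>i<r. min (c i) (t - 1))\<close> elements, fewer than \<open>k\<close>. So
  any \<open>k\<close> vertices include \<open>t\<close> from one clique.\<close>

lemma nktr_graph_cluster:
  assumes c: "\<And>i. i < r \<Longrightarrow> 0 < c i" and n: "(\<Sum>i<r. c i) = n"
    and t: "t \<ge> 1" and k: "(\<Sum>i<r. min (c i) (t - 1)) < k"
  shows "nktr_graph n k t r (cluster_verts r c) (cluster_edges r c)"
proof -
  have "\<exists>T\<subseteq>S. card T = t \<and> clique T (induced_edges (cluster_edges r c) S)"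
    if S: "S \<subseteq> cluster_verts r c" "card S = k" for S
  proof -
    define A where "A = (\<lambda>i. S \<inter> {i} \<times> {..<c i})"
    have finA: "finite (A i)" for i by (simp add: A_def)
    have "\<exists>i<r. t \<le> card (A i)"
    proof (rule ccontr)
      assume neg: "\<not> ?thesis"
      have "card (A i) \<le> min (c i) (t - 1)" if "i < r" for i
      proof -
        have "card (A i) \<le> card ({i} \<times> {..<c i})" by (intro card_mono) (auto simp: A_def)
        moreover have "card (A i) < t" using neg that by auto
        ultimately show ?thesis by (simp add: card_cartesian_product)
      qed
      then have "(\<Sum>i<r. card (A i)) \<le> (\<Sum>i<r. min (c i) (t - 1))" by (intro sum_mono) auto
      moreover have "S = (\<Union>i<r. A i)" using S(1) by (auto simp: A_def cluster_verts_def)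
      then have "card S \<le> (\<Sum>i<r. card (A i))" using card_UN_le[of "{..<r}" A] by simp
      ultimately show False using k S by simp
    qed
    then obtain i where i: "i < r" "t \<le> card (A i)" by blast
    then obtain T where T: "T \<subseteq> A i" "card T = t" by (meson obtain_subset_with_card_n)
    have "clique T (induced_edges (cluster_edges r c) S)"
      unfolding clique_def
    proof (intro ballI impI)
      fix p q assume pq: "p \<in> T" "q \<in> T" "p \<noteq> q"
      then have "p \<in> A i" "q \<in> A i" using T by auto
      then have "p \<in> S" "q \<in> S" "fst p = fst q" by (auto simp: A_def)
      then show "{p, q} \<in> induced_edges (cluster_edges r c) S"
        using pq S cluster_edge_iff[of p r c q] by (auto simp: induced_edges_def)
    qed
    then show ?thesis using T by (auto simp: A_def)
  qed
  moreover have "finite (cluster_verts r c)" "card (cluster_verts r c) = n"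
    using n by (auto simp: cluster_verts_def)
  moreover have "cluster_edges r c \<subseteq> [cluster_verts r c]\<^bsup>2\<^esup>"
    by (fastforce simp: cluster_edges_def cluster_verts_def nsets_def)
  ultimately show ?thesis
    using independence_number_cluster[OF c]
    by (auto simp: nktr_graph_def nkt_graph_def fin_sgraph_def)
qed

section \<open>Comparing a minimum graph with its competitor\<close>

theorem theorem4:
  fixes V :: "'a set" and E :: "'a set set" and n k t r :: nat
  assumes "n \<ge> k" and "k \<ge> t" and "t \<ge> 1" and "r \<ge> 1"
    and "min_nktr_graph n k t r V E"
  shows "disjoint_union_of_cliques V E"
proof (rule ccontr)
  assume not_union: "\<not> disjoint_union_of_cliques V E"
  have V: "finite V" and EV: "E \<subseteq> [V]\<^bsup>2\<^esup>" and n: "card V = n"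
    and r: "independence_number V E = r"
    and cl: "\<And>S. S \<subseteq> V \<Longrightarrow> card S = k \<Longrightarrow>
               \<exists>T. T \<subseteq> S \<and> card T = t \<and> clique T (induced_edges E S)"
    using assms(5)
    by (auto simp: min_nktr_graph_def nktr_graph_def nkt_graph_def fin_sgraph_def)
  have "\<not> cluster_on V E" using not_union disjoint_union_of_cliques_if_cluster_on[OF EV] by blast
  then obtain c where c: "\<And>i. 0 < c i \<longleftrightarrow> i < r" and csum: "(\<Sum>i<r. c i) = n"
    and lt: "(\<Sum>i<r. c i choose 2) < card E"
    and free: "\<And>s. \<exists>T\<subseteq>V. card T = (\<Sum>i<r. min (c i) s) \<and>
           (\<forall>X\<subseteq>T. clique X E \<longrightarrow> card X \<le> s)"
    using clique_sizes_exist[OF V, of E] EV unfolding r n by (auto simp: Int_absorb2)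
  obtain T where T: "T \<subseteq> V" "card T = (\<Sum>i<r. min (c i) (t - 1))"
    "\<And>X. X \<subseteq> T \<Longrightarrow> clique X E \<Longrightarrow> card X \<le> t - 1"
    using free[of "t - 1"] by blast
  \<comment> \<open>This carries the bound on \<open>k\<close> over to the competitor:
    \<open>k\<close> vertices inside \<open>T\<close> would contain a clique on \<open>t\<close>
    vertices, but cliques in \<open>T\<close> have at most \<open>t - 1\<close>.\<close>
  have "card T < k"
  proof (rule ccontr)
    assume "\<not> card T < k"
    then obtain S where S: "S \<subseteq> T" "card S = k" by (meson not_less obtain_subset_with_card_n)
    then obtain X where X: "X \<subseteq> S" "card X = t" "clique X (induced_edges E S)"
      using cl[of S] T by auto
    then have "clique X E" by (auto simp: clique_def induced_edges_def)
    then show False using T(3)[of X] subset_trans[OF X(1) S(1)] X(2) \<open>t \<ge> 1\<close> by simp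
  qed
  then have "nktr_graph n k t r (cluster_verts r c) (cluster_edges r c)"
    using c csum \<open>t \<ge> 1\<close> T(2) by (intro nktr_graph_cluster) auto
  \<comment> \<open>The competitor has pairs of natural numbers as vertices, so minimality is used
    in the form that allows another vertex type.\<close>
  then have "card E \<le> (\<Sum>i<r. c i choose 2)"
    using min_nktr_graph_le[OF assms(5)] card_cluster_edges by metis
  then show False using lt by simp
qed

end
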